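(* The map $g$ on $\beta(0,1)$-trees is an involution, i.e. $g(g(T))=T$ for every $\beta(0,1)$-tree $T$.
   Context: A $\beta(0,1)$-tree is a rooted plane tree (children linearly ordered left to right) whose nodes are labeled with nonnegative integers such that: leaves have label $0$; the label of the root is one more than the sum of its children's labels; the label of any other (non-leaf) node exceeds the sum of its children's labels by at most one. The trivial tree $\bullet$ has one node, whose label is $0$; all others are nontrivial. $\mathrm{root}(T)$ is the root label of $T$. The rightmost path is the path from the root to the rightmost leaf. A non-root node is excessive if its label exceeds the sum of its children's labels, and moderate otherwise (leaves are moderate); the root of a nontrivial tree is excessive. In a nontrivial tree, a node on the rightmost path (possibly the root) is open if its rightmost child, if any, is a non-leaf moderate node; in particular the rightmost leaf is open. $\mathrm{open}(T)$ is the number of open nodes of $T$, with $\mathrm{open}(\bullet)=0$. Sum: for nontrivial $U,V$, $U\oplus V$ is obtained by identifying the roots of $U$ and $V$ (children of $U$ to the left of those of $V$) into a new root with label $\mathrm{root}(U)+\mathrm{root}(V)-1$. For $0\le i\le \mathrm{root}(T)$, $\lambda_i(T)$ is obtained from $T$ by joining a new root by an edge to the old root; the old root gets label $i$ and the new root label $i+1$. Operation $\rho$: $\rho(T_1,\dots,T_k)=\lambda_0(T_1)\oplus\cdots\oplus\lambda_0(T_k)$, $k\ge1$. Operation $\mu_i$: let $\mathrm{root}(S)=1$, $T$ nontrivial, $1\le i\le \mathrm{open}(T)$. Let $x$ be the $i$th open node on the rightmost path of $T$ (counting from the root downwards); let $y=x$ if $x$ is a leaf, otherwise $y$ is the rightmost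 child of $x$ in $T$. $\mu_i(S,T)$ is obtained by identifying $x$ with the root of $S$ (children of the root of $S$ placed to the right of the children of $x$), keeping the label of $x$, and then adding $1$ to the label of each node on the rightmost path of $T$ from the root to $y$ (both inclusive). Also $\mu_1(S,\bullet)=S$. Operation $\sigma$: $\sigma(T_1,\dots,T_k)=\mu_1(\rho(T_{k-1},\dots,T_1,\bullet),T_k)$, $k\ge1$. Operation $\nu_i$: let $\mathrm{open}(S)=1$, $T$ nontrivial, $1\le i\le\mathrm{root}(T)$, and let $x$ be the rightmost leaf of $S$. $\nu_i(S,T)$ is obtained by identifying $x$ with the root of $T$, keeping the (zero) label of $x$, and then adding $i-1$ to the label of each node on the rightmost path of $S$ from the root to $x$ (both inclusive). Also $\nu_1(S,\bullet)=S$. Every $\beta(0,1)$-tree $U$ with $\mathrm{root}(U)=1$ is uniquely of the form $\rho(T_1,\dots,T_k)$, and every $U$ with $\mathrm{root}(U)>1$ is uniquely of the form $\mu_i(S,T)$ with $\mathrm{root}(S)=1$ and $T$ nontrivial. The map $g$ is defined recursively by: $g(\bullet)=\bullet$; $g(\rho(T_1,\dots,T_k))=\sigma(g(T_1),\dots,g(T_k))$; and $g(\mu_i(S,T))=\nu_i(g(S),g(T))$ whenever $\mathrm{root}(S)=1$. (The applications of $\nu_i$ here are legitimate, so $g$ is well defined.) *)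

theory Defs
  imports Main
begin

datatype tree = Node (lab: nat) (kids: "tree list")

abbreviation bullet :: tree  ("\<bullet>")
  where "\<bullet> \<equiv> Node 0 []"

abbreviation is_leaf :: "tree \<Rightarrow> bool"
  where "is_leaf t \<equiv> kids t = []"

definition kid_sum :: "tree \<Rightarrow> nat"
  where "kid_sum t = sum_list (map lab (kids t))"

text \<open>The label condition for a non-root node, imposed on all nodes of a proper subtree.\<close>

fun valid_subtree :: "tree \<Rightarrow> bool"
  where "valid_subtree (Node a ts) \<longleftrightarrow>
    (if ts = [] then a = 0 else a \<le> kid_sum (Node a ts) + 1) \<and> (\<forall>t\<in>set ts. valid_subtree t)"

definition beta01_tree :: "tree \<Rightarrow> bool"
  where "beta01_tree T \<longleftrightarrow>
    T = \<bullet> \<or>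
    (\<not> is_leaf T \<and> lab T = kid_sum T + 1 \<and> (\<forall>t\<in>set (kids T). valid_subtree t))"

lemma size_last_less [termination_simp]:
  "ts \<noteq> [] \<Longrightarrow> size (last ts) < Suc (size_list size ts)"
  by (induction ts) auto

text \<open>A node on the rightmost path is addressed by its depth; \<open>rpath T ! d\<close> is the
  subtree hanging at the node of depth \<open>d\<close>.\<close>

fun rpath :: "tree \<Rightarrow> tree list"
  where "rpath (Node a ts) = Node a ts # (if ts = [] then [] else rpath (last ts))"

text \<open>The next two notions are only used for non-root nodes, where a node is
  represented by the subtree hanging at it.\<close>

definition excessive :: "tree \<Rightarrow> bool"
  where "excessive t \<longleftrightarrow> lab t > kid_sum t"

abbreviation moderate :: "tree \<Rightarrow> bool"
  where "moderate t \<equiv> \<not> excessive t"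

definition open_node :: "tree \<Rightarrow> bool"
  where "open_node t \<longleftrightarrow>
    is_leaf t \<or> (\<not> is_leaf (last (kids t)) \<and> moderate (last (kids t)))"

text \<open>The depths of the open nodes of a nontrivial tree, from the root downwards.\<close>

definition open_depths :: "tree \<Rightarrow> nat list"
  where "open_depths T = filter (\<lambda>d. open_node (rpath T ! d)) [0..<length (rpath T)]"

definition num_open :: "tree \<Rightarrow> nat"
  where "num_open T = (if T = \<bullet> then 0 else length (open_depths T))"

text \<open>Apply \<open>f\<close> to the subtree hanging at the node of depth \<open>d\<close> on the rightmost path.\<close>

fun modify_at :: "nat \<Rightarrow> (tree \<Rightarrow> tree) \<Rightarrow> tree \<Rightarrow> tree"
  where
    "modify_at 0 f t = f t"
  | "modify_at (Suc d) f (Node a ts) =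
      Node a (if ts = [] then [] else butlast ts @ [modify_at d f (last ts)])"

text \<open>Add \<open>k\<close> to the labels of the nodes of depth at most \<open>d\<close> on the rightmost path.\<close>

fun add_path :: "nat \<Rightarrow> nat \<Rightarrow> tree \<Rightarrow> tree"
  where
    "add_path k 0 (Node a ts) = Node (a + k) ts"
  | "add_path k (Suc d) (Node a ts) =
      Node (a + k) (if ts = [] then [] else butlast ts @ [add_path k d (last ts)])"

definition oplus :: "tree \<Rightarrow> tree \<Rightarrow> tree"  (infixr "\<oplus>" 65)
  where "U \<oplus> V = Node (lab U + lab V - 1) (kids U @ kids V)"

definition lam :: "nat \<Rightarrow> tree \<Rightarrow> tree"
  where "lam i T = Node (i + 1) [Node i (kids T)]"

text \<open>Only used for nonempty lists; the value at the empty list is left unspecified.\<close>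

fun rho :: "tree list \<Rightarrow> tree"
  where
    "rho [T] = lam 0 T"
  | "rho (T # T' # Ts) = lam 0 T \<oplus> rho (T' # Ts)"

text \<open>Meaningful for \<open>lab S = 1\<close> and \<open>1 \<le> i \<le> num_open T\<close> (or \<open>T = \<bullet>\<close> and \<open>i = 1\<close>).
  Here \<open>d\<close> and \<open>e\<close> are the depths of the nodes \<open>x\<close> and \<open>y\<close>.  The labels are
  raised before the gluing, because the path from the root to \<open>y\<close> is a path of \<open>T\<close>; in
  the glued tree \<open>y\<close> need not lie on the rightmost path any more.\<close>

definition mu :: "nat \<Rightarrow> tree \<Rightarrow> tree \<Rightarrow> tree"
  where "mu i S T =
    (if T = \<bullet> then S
     else let d = open_depths T ! (i - 1);
              e = (if is_leaf (rpath T ! d) then d else d + 1)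
          in modify_at d (\<lambda>x. Node (lab x) (kids x @ kids S)) (add_path 1 e T))"

definition sigma :: "tree list \<Rightarrow> tree"
  where "sigma Ts = mu 1 (rho (rev (butlast Ts) @ [\<bullet>])) (last Ts)"

text \<open>Meaningful for \<open>num_open S = 1\<close> and \<open>1 \<le> i \<le> lab T\<close> (or \<open>T = \<bullet>\<close> and \<open>i = 1\<close>).
  Here \<open>d\<close> is the depth of the rightmost leaf of \<open>S\<close>.\<close>

definition nu :: "nat \<Rightarrow> tree \<Rightarrow> tree \<Rightarrow> tree"
  where "nu i S T =
    (if T = \<bullet> then S
     else let d = length (rpath S) - 1
          in add_path (i - 1) d (modify_at d (\<lambda>x. Node (lab x) (kids T)) S))"

text \<open>The graph of \<open>g\<close>, one rule for each recursion equation.  The case \<open>T = \<bullet>\<close>, \<open>i = 1\<close>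
  is omitted from the last rule: there \<open>mu 1 S \<bullet> = S\<close> and \<open>nu 1 S' \<bullet> = S'\<close>.\<close>

inductive g_graph :: "tree \<Rightarrow> tree \<Rightarrow> bool"
  where
    bullet: "g_graph \<bullet> \<bullet>"
  | rho: "\<lbrakk>Ts \<noteq> []; list_all beta01_tree Ts; list_all2 g_graph Ts Us\<rbrakk>
      \<Longrightarrow> g_graph (rho Ts) (sigma Us)"
  | mu: "\<lbrakk>beta01_tree S; lab S = 1; beta01_tree T; T \<noteq> \<bullet>; 1 \<le> i; i \<le> num_open T;
       g_graph S S'; g_graph T T'\<rbrakk>
      \<Longrightarrow> g_graph (mu i S T) (nu i S' T')"

definition g :: "tree \<Rightarrow> tree"
  where "g T = (THE U. g_graph T U)"

end

theory Submission
  imports Defs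
begin

text \<open>
  The graph of \<open>g\<close> is symmetric, i.e. \<open>g\<close> also satisfies the recursion in which \<open>\<rho>\<close> is
  exchanged with \<open>\<sigma>\<close> and \<open>\<mu>\<close> with \<open>\<nu>\<close>.  For \<open>\<sigma>\<close> this follows from
  \<open>\<nu>\<^sub>1(\<rho>(T\<^sub>1,\<dots>,T\<^sub>k,\<bullet>), T) = \<rho>(T\<^sub>1,\<dots>,T\<^sub>k,T)\<close>.  For \<open>\<nu>\<close> it rests on two self-dual laws:
  \<open>\<mu>\<^bsub>j+1\<^esub>(C, \<nu>\<^sub>i(S,D)) = \<nu>\<^bsub>i+1\<^esub>(S, \<mu>\<^sub>j(C,D))\<close>, which reduces \<open>\<nu>\<^sub>i\<close> to \<open>\<nu>\<^sub>1\<close> by induction on \<open>i\<close>,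
  and \<open>\<nu>\<^sub>1(\<mu>\<^sub>1(A,B), T) = \<mu>\<^sub>1(\<nu>\<^sub>1(A,T), B)\<close>, which reduces \<open>\<nu>\<^sub>1(S,T)\<close> to the case where \<open>S\<close>
  has root label 1.  That the graph is a function is the uniqueness of the decompositions:
  in \<open>\<mu>\<^sub>i(S,T)\<close> the glueing node is the first node on the rightmost path whose rightmost child
  has label 0, and \<open>S\<close> hangs at the maximal final run of children labeled 0.
\<close>

section \<open>Recursion along the rightmost path\<close>

text \<open>Functions on the rightmost path recurse through \<open>last\<close> and
  \<open>butlast\<close>; writing the children as \<open>ts @ [t]\<close> lets the simplifier
  evaluate both.\<close>

lemma rpath_induct [case_names leaf snoc]:
  assumes "\<And>a. P (Node a [])" and "\<And>a ts t. P t \<Longrightarrow> P (Node a (ts @ [t]))"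
  shows "P t"
proof (induction t rule: rpath.induct)
  case (1 a ts)
  then show ?case
    using assms by (cases ts rule: rev_cases) auto
qed

lemma rpath_exhaust [case_names Leaf Snoc]:
  obtains a where "t = Node a []" | a ts u where "t = Node a (ts @ [u])"
  by (induction t rule: rpath_induct) blast+

text \<open>The condition on a last child under which its parent is open.\<close>

abbreviation opener :: "tree \<Rightarrow> bool"
  where "opener t \<equiv> \<not> is_leaf t \<and> moderate t"

text \<open>Recursive forms of \<open>\<mu>\<close>, with the open nodes counted from 0, and of \<open>\<nu>\<close>.\<close>

fun graft :: "nat \<Rightarrow> tree list \<Rightarrow> tree \<Rightarrow> tree"
  where "graft i ss (Node a ts) = Node (a + 1)
    (if ts = [] then ss
     else if \<not> opener (last ts) then butlast ts @ [graft i ss (last ts)]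
     else if i = 0 then butlast ts @ Node (lab (last ts) + 1) (kids (last ts)) # ss
     else butlast ts @ [graft (i - 1) ss (last ts)])"

fun plant :: "nat \<Rightarrow> tree list \<Rightarrow> tree \<Rightarrow> tree"
  where "plant c ks (Node a ts) =
    Node (a + c) (if ts = [] then ks else butlast ts @ [plant c ks (last ts)])"

lemma open_depths_leaf [simp]: "open_depths (Node a []) = [0]"
  by (simp add: open_depths_def open_node_def)

lemma open_depths_snoc [simp]:
  "open_depths (Node a (ts @ [t])) = (if opener t then [0] else []) @ map Suc (open_depths t)"
proof -
  have *: "[0..<Suc n] = 0 # map Suc [0..<n]" for n
    by (simp add: map_Suc_upt upt_conv_Cons del: upt_Suc)
  show ?thesis
    unfolding open_depths_def rpath.simps
    by (simp add: * filter_map o_def open_node_def del: upt_Suc)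
qed

abbreviation opens :: "tree \<Rightarrow> nat"
  where "opens t \<equiv> length (open_depths t)"

lemma opens_pos: "opens t > 0"
  by (induction t rule: rpath_induct) auto

lemma opens_relabel: "opens (Node a ts) = opens (Node b ts)"
  by (cases ts rule: rev_cases) auto

lemma opens_append: "ss \<noteq> [] \<Longrightarrow> opens (Node a (ts @ ss)) = opens (Node b ss)"
  by (cases ss rule: rev_cases) (auto simp flip: append_assoc)

section \<open>Child sums and the label conditions\<close>

lemma kid_sum_simps [simp]:
  "kid_sum (Node a []) = 0"
  "kid_sum (Node a (ts @ us)) = kid_sum (Node a ts) + kid_sum (Node a us)"
  "kid_sum (Node a (t # ts)) = lab t + kid_sum (Node a ts)"
  by (auto simp: kid_sum_def)

text \<open>As a rewrite rule this normalises the dummy root label to 0; \<open>NO_MATCH\<close>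
  stops it from looping on its own result.\<close>

lemma kid_sum_relabel: "NO_MATCH 0 a \<Longrightarrow> kid_sum (Node a ts) = kid_sum (Node 0 ts)"
  by (simp add: kid_sum_def)

text \<open>The root of a nontrivial tree obeys the rules for an excessive non-root node, so inductions
  along the rightmost path need not treat the root separately.\<close>

lemma beta01_tree_iff: "beta01_tree T \<longleftrightarrow> T = \<bullet> \<or> valid_subtree T \<and> excessive T"
  by (cases T) (auto simp: beta01_tree_def excessive_def)

lemma beta01_treeD:
  assumes "beta01_tree T" "T \<noteq> \<bullet>"
  shows "valid_subtree T" "excessive T" "kids T \<noteq> []" "lab T = kid_sum T + 1"
  using assms by (cases T; auto simp: beta01_tree_iff excessive_def split: if_splits)+

lemma beta01_tree_lab_0: "beta01_tree T \<Longrightarrow> lab T = 0 \<longleftrightarrow> T = \<bullet>"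
  by (metis beta01_treeD(4) add_is_0 one_neq_zero tree.sel(1))

lemma num_open_0: "num_open T = 0 \<longleftrightarrow> T = \<bullet>"
  using opens_pos[of T] by (auto simp: num_open_def)

lemma num_open_nontrivial: "kids T \<noteq> [] \<Longrightarrow> num_open T = opens T"
  by (auto simp: num_open_def)

lemma mu_bullet [simp]: "mu i S \<bullet> = S"
  by (simp add: mu_def)

lemma mu_eq_graft:
  assumes "T \<noteq> \<bullet>" "1 \<le> i" "i \<le> num_open T"
  shows "mu i S T = graft (i - 1) (kids S) T"
proof -
  \<comment> \<open>The induction may end in \<bullet>, where \<open>num_open\<close> is 0 but
    \<open>opens\<close> is 1; hence the bound by \<open>opens\<close>.\<close>
  have "(let d = open_depths t ! j; e = if is_leaf (rpath t ! d) then d else d + 1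
      in modify_at d (\<lambda>x. Node (lab x) (kids x @ kids S)) (add_path 1 e t)) = graft j (kids S) t"
    if "j < opens t" for j t
    using that
  proof (induction t arbitrary: j rule: rpath_induct)
    case (snoc a ts t)
    \<comment> \<open>Needed if the root is the glueing node \<open>x\<close>: then \<open>y\<close>
      is the last child \<open>t\<close>, and below the root only its label is raised.\<close>
    have root: "add_path 1 0 t = Node (lab t + 1) (kids t)"
      by (cases t) auto
    show ?case
    proof (cases "opener t")
      case True
      then show ?thesis
        using snoc.IH[of "j - 1"] snoc.prems root by (cases j) (auto simp: Let_def split: if_splits)
    next
      case False
      then show ?thesis
        using snoc.IH[of j] snoc.prems by (auto simp: Let_def split: if_splits)
    qed
  qed auto
  moreover have "i - 1 < opens T"
    using assms by (auto simp: num_open_def)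
  ultimately show ?thesis
    using assms(1) by (simp add: mu_def)
qed

lemma nu_bullet [simp]: "nu i S \<bullet> = S"
  by (simp add: nu_def)

lemma nu_eq_plant:
  assumes "T \<noteq> \<bullet>"
  shows "nu i S T = plant (i - 1) (kids T) S"
proof -
  have "(let d = length (rpath s) - 1
      in add_path c d (modify_at d (\<lambda>x. Node (lab x) (kids T)) s)) = plant c (kids T) s" for c s
  proof (induction s rule: rpath_induct)
    case (snoc a ts t)
    obtain n where "length (rpath t) = Suc n"
      by (cases t) auto
    then show ?case
      using snoc by (auto simp: Let_def)
  qed auto
  then show ?thesis
    using assms by (simp add: nu_def)
qed

section \<open>Grafting: validity, open nodes and inversion\<close>

lemma kids_graft_ne: "ss \<noteq> [] \<Longrightarrow> kids (graft i ss t) \<noteq> []"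
  by (cases t) auto

lemma lab_graft [simp]: "lab (graft i ss t) = lab t + 1"
  by (cases t) auto

text \<open>Unless \<open>t\<close> is a leaf, exactly one child has its label raised by 1, whether
  the glueing takes place here or below; the trees in \<open>ss\<close> contribute 0.\<close>

lemma kid_sum_graft:
  assumes "\<forall>s\<in>set ss. lab s = 0"
  shows "kid_sum (graft i ss t) = (if is_leaf t then 0 else kid_sum t + 1)"
proof -
  have "kid_sum (Node 0 ss) = 0"
    using assms by (simp add: kid_sum_def)
  then show ?thesis
    by (cases t; cases "kids t" rule: rev_cases) (auto simp: kid_sum_relabel)
qed

lemma excessive_graft:
  assumes "\<forall>s\<in>set ss. lab s = 0"
  shows "excessive (graft i ss t) \<longleftrightarrow> is_leaf t \<or> excessive t"
  by (auto simp: excessive_def kid_sum_graft[OF assms])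

lemma valid_subtree_Node:
  "valid_subtree t \<longleftrightarrow> (if is_leaf t then lab t = 0 else lab t \<le> kid_sum t + 1) \<and>
    (\<forall>s\<in>set (kids t). valid_subtree s)"
  by (cases t) auto

lemma valid_subtree_graft:
  assumes "ss \<noteq> []" "\<forall>s\<in>set ss. lab s = 0 \<and> valid_subtree s"
    and "valid_subtree t" "i < opens t"
  shows "valid_subtree (graft i ss t)"
  using assms(3,4)
proof (induction t arbitrary: i rule: rpath_induct)
  case (leaf a)
  then show ?case
    using assms(1,2) by auto
next
  case (snoc a ts t)
  \<comment> \<open>A moderate child has room for the increment; this is where openness of the
    glueing node matters.\<close>
  have "valid_subtree (Node (Suc (lab t)) (kids t))" if "opener t"
    using snoc.prems that by (cases t) (auto simp: excessive_def kid_sum_relabel)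
  then have "\<forall>s\<in>set (kids (graft i ss (Node a (ts @ [t])))). valid_subtree s"
    using snoc.prems snoc.IH[of i] snoc.IH[of "i - 1"] assms(2) by (auto split: if_splits)
  moreover have "lab (graft i ss (Node a (ts @ [t]))) \<le> kid_sum (graft i ss (Node a (ts @ [t]))) + 1"
    using snoc.prems kid_sum_graft[of ss i "Node a (ts @ [t])"] assms(2) by auto
  ultimately show ?case
    using kids_graft_ne[OF assms(1)] by (simp only: valid_subtree_Node[of "graft _ _ _"] if_False)
qed

text \<open>By \<open>excessive_graft\<close> the nodes above the glueing node stay open or closed
  as they were; from the glueing node on, the path runs through \<open>ss\<close>.\<close>

lemma opens_graft:
  assumes "ss \<noteq> []" "\<forall>s\<in>set ss. lab s = 0" "i < opens t"
  shows "opens (graft i ss t) = i + opens (Node b ss)"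
  using assms(3)
proof (induction t arbitrary: i rule: rpath_induct)
  case (leaf a)
  then show ?case
    using opens_relabel[of "Suc a" ss b] by simp
next
  case (snoc a ts t)
  have "opens (Node (Suc a) (ts @ u # ss)) = opens (Node b ss)" for u
    using opens_append[OF assms(1), of _ "ts @ [u]"] by simp
  then show ?case
    using snoc.prems snoc.IH[of i] snoc.IH[of "i - 1"]
    by (auto simp: kids_graft_ne[OF assms(1)] excessive_graft[OF assms(2)])
qed

lemma size_graft:
  "i < opens t \<Longrightarrow> size (graft i ss t) = size t + size_list size ss"
proof (induction t arbitrary: i rule: rpath_induct)
  case (snoc a ts t)
  have "size (Node x (kids t)) = size t" for x
    by (cases t) auto
  then show ?case
    using snoc.prems snoc.IH[of i] snoc.IH[of "i - 1"] by (auto simp: size_list_append)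
qed auto

text \<open>Both \<open>p\<close> and \<open>q\<close> are the last entry of nonzero label.\<close>

lemma append_Cons_zero_labels_eq:
  assumes "xs @ p # ss = ys @ q # us"
    and "\<forall>s\<in>set ss. lab s = 0" "\<forall>s\<in>set us. lab s = 0" "lab p \<noteq> 0" "lab q \<noteq> 0"
  shows "xs = ys \<and> p = q \<and> ss = us"
proof -
  have *: "takeWhile (\<lambda>s. lab s = 0) (rev (zs @ r # vs)) = rev vs"
    if "\<forall>s\<in>set vs. lab s = 0" "lab r \<noteq> 0" for zs r vs
    using that by (auto simp: takeWhile_append)
  have "ss = us"
    using *[of ss p xs] *[of us q ys] assms by (metis rev_rev_ident)
  then show ?thesis
    using assms(1) by auto
qed

lemma graft_here:
  "opener t \<and> i = 0 \<Longrightarrow>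
    graft i ss (Node a (ts @ [t])) = Node (a + 1) (ts @ Node (lab t + 1) (kids t) # ss)"
  by auto

lemma graft_below:
  "\<not> (opener t \<and> i = 0) \<Longrightarrow>
    graft i ss (Node a (ts @ [t])) = Node (a + 1) (ts @ [graft (if opener t then i - 1 else i) ss t])"
  by auto

lemma graft_inject:
  assumes "ss \<noteq> []" "\<forall>s\<in>set ss. lab s = 0" "us \<noteq> []" "\<forall>s\<in>set us. lab s = 0"
    and "graft i ss t = graft j us v" "i < opens t" "j < opens v"
  shows "i = j \<and> ss = us \<and> t = v"
  using assms(5-7)
proof (induction t arbitrary: i j v rule: rpath_induct)
  case (leaf a)
  then show ?case
    using assms(1-4) by (cases v rule: rpath_exhaust) (auto split: if_splits)
next
  case (snoc a ts t)
  show ?case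
  proof (cases v rule: rpath_exhaust)
    case (Leaf b)
    then show ?thesis
      using snoc.prems assms(1-4) by (auto split: if_splits)
  next
    case (Snoc b vs w)
    \<comment> \<open>Glueing at the root leaves a last child of label 0, a graft further down one
      of label at least 1. This rules out the mixed cases \<open>left\<close> and
      \<open>right\<close>.\<close>
    have zero: "lab (last (xs @ x # ss)) = 0" "lab (last (xs @ x # us)) = 0" for xs x
      using assms(1-4) by (simp_all add: last_in_set)
    consider (glue) "opener t \<and> i = 0" "opener w \<and> j = 0"
      | (left) "opener t \<and> i = 0" "\<not> (opener w \<and> j = 0)"
      | (right) "\<not> (opener t \<and> i = 0)" "opener w \<and> j = 0"
      | (deep) "\<not> (opener t \<and> i = 0)" "\<not> (opener w \<and> j = 0)"
      by blast
    then show ?thesis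
    proof cases
      case glue
      then have "ts @ Node (lab t + 1) (kids t) # ss = vs @ Node (lab w + 1) (kids w) # us" "a = b"
        using snoc.prems(1) unfolding Snoc graft_here[OF glue(1)] graft_here[OF glue(2)] by auto
      then have "ts = vs \<and> Node (lab t + 1) (kids t) = Node (lab w + 1) (kids w) \<and> ss = us"
        using assms(2,4) by (intro append_Cons_zero_labels_eq) simp_all
      then show ?thesis
        using \<open>a = b\<close> glue Snoc by (auto intro: tree.expand)
    next
      case left
      then have "ts @ Node (lab t + 1) (kids t) # ss = vs @ [graft (if opener w then j - 1 else j) us w]"
        using snoc.prems(1) unfolding Snoc graft_here[OF left(1)] graft_below[OF left(2)] by simp
      then show ?thesis
        using zero(1) by (metis last_snoc lab_graft add_is_0 one_neq_zero)
    next
      case right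
      then have "vs @ Node (lab w + 1) (kids w) # us = ts @ [graft (if opener t then i - 1 else i) ss t]"
        using snoc.prems(1) unfolding Snoc graft_below[OF right(1)] graft_here[OF right(2)] by simp
      then show ?thesis
        using zero(2) by (metis last_snoc lab_graft add_is_0 one_neq_zero)
    next
      case deep
      define x y where "x = (if opener t then i - 1 else i)" and "y = (if opener w then j - 1 else j)"
      have "graft x ss t = graft y us w" and eqs: "a = b" "ts = vs"
        using snoc.prems(1) unfolding Snoc x_def y_def graft_below[OF deep(1)] graft_below[OF deep(2)]
        by simp_all
      moreover have "x < opens t" "y < opens w"
        using snoc.prems(2,3) deep unfolding Snoc x_def y_def by (auto split: if_splits)
      ultimately have "x = y \<and> ss = us \<and> t = w"
        using snoc.IH by blast
      then show ?thesis
        using deep eqs unfolding Snoc x_def y_def by (auto split: if_splits)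
    qed
  qed
qed

text \<open>Descend through last children of positive label until the last child has label 0. The
  descent ends because valid leaves have label 0.\<close>

lemma graft_cases:
  assumes "valid_subtree u" "lab u > 0"
  obtains i ss t where "u = graft i ss t" "i < opens t" "valid_subtree t"
    "ss \<noteq> []" "\<forall>s\<in>set ss. lab s = 0 \<and> valid_subtree s"
proof -
  have "\<exists>i ss t. u = graft i ss t \<and> i < opens t \<and> valid_subtree t \<and>
    ss \<noteq> [] \<and> (\<forall>s\<in>set ss. lab s = 0 \<and> valid_subtree s)"
    using assms
  proof (induction u rule: rpath_induct)
    case (snoc a us u)
    show ?case
    proof (cases "lab u = 0")
      case False
      then obtain i ss t where *: "u = graft i ss t" "i < opens t" "valid_subtree t"
        "ss \<noteq> []" "\<forall>s\<in>set ss. lab s = 0 \<and> valid_subtree s"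
        using snoc by auto
      \<comment> \<open>The new root is one more open node above the glueing node exactly if
        \<open>t\<close> is an opener.\<close>
      let ?t = "Node (a - 1) (us @ [t])" and ?i = "if opener t then i + 1 else i"
      have "Node a (us @ [u]) = graft ?i ss ?t" "?i < opens ?t" "valid_subtree ?t"
        using * snoc.prems by (auto simp: kid_sum_relabel)
      then show ?thesis
        using * by metis
    next
      case True
      show ?thesis
      proof (cases "\<exists>p\<in>set us. lab p \<noteq> 0")
        case False
        \<comment> \<open>So \<open>a\<close> is 1, and the glueing node was a leaf.\<close>
        then have "kid_sum (Node a (us @ [u])) = 0"
          using True by (auto simp: kid_sum_def)
        then have "Node a (us @ [u]) = graft 0 (us @ [u]) \<bullet>" "0 < opens \<bullet>" "valid_subtree \<bullet>"
          using snoc.prems by auto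
        moreover have "\<forall>s\<in>set (us @ [u]). lab s = 0 \<and> valid_subtree s"
          using False True snoc.prems by auto
        ultimately show ?thesis
          by blast
      next
        case pos: True
        obtain ts p zs where us: "us = ts @ p # zs" "lab p \<noteq> 0" "\<forall>s\<in>set zs. lab s = 0"
          using split_list_last_prop[OF pos] by blast
        \<comment> \<open>Lowering the last positive child label makes that child moderate, so the
          root is the first open node of \<open>?t\<close>.\<close>
        let ?p = "Node (lab p - 1) (kids p)"
        let ?t = "Node (a - 1) (ts @ [?p])" and ?ss = "zs @ [u]"
        have zero: "kid_sum (Node 0 zs) = 0"
          using us(3) by (simp add: kid_sum_def)
        have p: "valid_subtree p"
          using snoc.prems us(1) by simp
        then have "valid_subtree ?p" "opener ?p"
          using us(2) by (cases p; auto simp: kid_sum_relabel excessive_def split: if_splits)+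
        moreover have "a \<le> kid_sum (Node 0 ts) + lab p + 1"
          using snoc.prems zero True us(1) by (simp add: kid_sum_relabel)
        ultimately have "valid_subtree ?t" "0 < opens ?t" "Node a (us @ [u]) = graft 0 ?ss ?t"
          using snoc.prems us(1,2) by (auto simp: kid_sum_relabel)
        moreover have "\<forall>s\<in>set ?ss. lab s = 0 \<and> valid_subtree s"
          using us True snoc.prems by auto
        ultimately show ?thesis
          by blast
      qed
    qed
  qed auto
  then show thesis
    using that by blast
qed

section \<open>Planting: validity and open nodes\<close>

lemma kids_plant_ne: "ks \<noteq> [] \<Longrightarrow> kids (plant c ks s) \<noteq> []"
  by (cases s) auto

lemma lab_plant [simp]: "lab (plant c ks s) = lab s + c"
  by (cases s) auto

lemma kid_sum_plant:
  "kid_sum (plant c ks s) = (if is_leaf s then kid_sum (Node 0 ks) else kid_sum s + c)"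
  by (cases s; cases "kids s" rule: rev_cases) (auto simp: kid_sum_relabel)

lemma excessive_plant: "\<not> is_leaf s \<Longrightarrow> excessive (plant c ks s) \<longleftrightarrow> excessive s"
  by (auto simp: excessive_def kid_sum_plant)

lemma valid_subtree_plant:
  assumes "ks \<noteq> []" "\<forall>k\<in>set ks. valid_subtree k" "c \<le> kid_sum (Node 0 ks)" "valid_subtree s"
  shows "valid_subtree (plant c ks s)"
  using assms(4)
proof (induction s rule: rpath_induct)
  case (leaf a)
  then show ?case
    using assms(1-3) by (auto simp: kid_sum_relabel)
qed (auto simp: kid_sum_relabel)

text \<open>A leaf receives a label within the sum of its new children and becomes moderate; a
  non-leaf gains \<open>c\<close> both in its label and in its child sum.\<close>

lemma opener_plant:
  assumes "ks \<noteq> []" "c \<le> kid_sum (Node 0 ks)" "valid_subtree s"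
  shows "opener (plant c ks s) \<longleftrightarrow> is_leaf s \<or> opener s"
proof (cases "is_leaf s")
  case True
  then have "lab s = 0"
    using assms(3) by (cases s) auto
  then show ?thesis
    using True assms kids_plant_ne by (auto simp: excessive_def kid_sum_plant)
qed (use assms kids_plant_ne in \<open>auto simp: excessive_plant\<close>)

lemma opens_snoc_1:
  "opens (Node a (ts @ [t])) = 1 \<longleftrightarrow> opens t = 1 \<and> \<not> opener t"
  using opens_pos[of t] by auto

text \<open>Only the leaf of \<open>s\<close> is open. Planting opens its parent, if there is one,
  and continues with the open nodes of the planted tree.\<close>

lemma opens_plant:
  assumes "ks \<noteq> []" "c \<le> kid_sum (Node 0 ks)" "valid_subtree s" "opens s = 1"
  shows "opens (plant c ks s) = opens (Node b ks) + (if is_leaf s then 0 else 1)"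
  using assms(3,4)
proof (induction s rule: rpath_induct)
  case (leaf a)
  then show ?case
    using opens_relabel[of c ks b] by simp
next
  case (snoc a ts t)
  then have "opens t = 1" "\<not> opener t"
    unfolding opens_snoc_1 by blast+
  then show ?case
    using snoc opener_plant[OF assms(1,2), of t] by auto
qed

section \<open>Commutation of grafting and planting\<close>

text \<open>The parent of the former leaf, if any, is open and precedes the open nodes of
  \<open>t\<close>, whence the shift of \<open>j\<close>. The graft raises the path through
  \<open>s\<close> once more, so \<open>c\<close> becomes \<open>c + 1\<close>.\<close>

lemma graft_plant:
  assumes "kids t \<noteq> []" "c \<le> kid_sum t" "valid_subtree s" "opens s = 1"
  shows "graft (if is_leaf s then j else j + 1) ss (plant c (kids t) s) =
    plant (c + 1) (kids (graft j ss t)) s"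
  using assms(3,4)
proof (induction s rule: rpath_induct)
  case (leaf a)
  then show ?case
    using assms(1) by (cases t) auto
next
  case (snoc a ts s)
  have "c \<le> kid_sum (Node 0 (kids t))"
    using assms(2) by (simp add: kid_sum_def)
  moreover have "opens s = 1" "\<not> opener s"
    using snoc.prems unfolding opens_snoc_1 by blast+
  ultimately show ?case
    using snoc opener_plant[OF assms(1), of c s] by auto
qed

text \<open>The rightmost leaf of the graft lies in \<open>ss\<close>, and planting with increment 0
  keeps the old labels on the path, so it acts inside \<open>ss\<close> alone.
  \<open>Node b ss\<close> merely wraps the list into a tree.\<close>

lemma plant_0_graft_0:
  assumes "ss \<noteq> []"
  shows "plant 0 ks (graft 0 ss t) = graft 0 (kids (plant 0 ks (Node b ss))) t"
proof (induction t rule: rpath_induct)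
  case (snoc a ts t)
  show ?case
    using assms snoc by (cases ss rule: rev_cases) (auto simp: butlast_append)
qed auto

section \<open>Root label and open nodes under the four operations\<close>

lemma kid_sum_kids [simp]: "kid_sum (Node a (kids t)) = kid_sum t"
  by (simp add: kid_sum_def)

text \<open>Root label 1 makes the child sum 0; this supplies what the \<open>graft\<close> lemmas
  ask of \<open>ss\<close>.\<close>

lemma zero_labels:
  assumes "beta01_tree S" "lab S = 1"
  shows "kids S \<noteq> []" "\<forall>s\<in>set (kids S). lab s = 0 \<and> valid_subtree s"
proof -
  have S: "S \<noteq> \<bullet>"
    using assms(2) by auto
  then show "kids S \<noteq> []"
    using assms beta01_treeD by blast
  have "kid_sum S = 0" "valid_subtree S"
    using beta01_treeD[OF assms(1) S] assms(2) by auto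
  then show "\<forall>s\<in>set (kids S). lab s = 0 \<and> valid_subtree s"
    by (cases S) (auto simp: kid_sum_def)
qed

text \<open>Exchanging \<open>lab\<close> with \<open>num_open\<close> turns these two formulas into
  those of \<open>beta01_nu\<close>.\<close>

lemma beta01_mu:
  assumes "beta01_tree S" "lab S = 1" "beta01_tree T" "T \<noteq> \<bullet>" "1 \<le> i" "i \<le> num_open T"
  shows "beta01_tree (mu i S T)" "lab (mu i S T) = lab T + 1"
    "num_open (mu i S T) = num_open S + i - 1"
proof -
  note z = zero_labels[OF assms(1,2)] and T = beta01_treeD[OF assms(3,4)]
  have i: "i - 1 < opens T"
    using assms by (auto simp: num_open_def)
  have mu: "mu i S T = graft (i - 1) (kids S) T"
    by (rule mu_eq_graft) (use assms in auto)
  show "beta01_tree (mu i S T)"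
    using valid_subtree_graft[OF z T(1) i] excessive_graft[of "kids S" "i - 1" T] z T
    by (simp add: mu beta01_tree_iff)
  show "lab (mu i S T) = lab T + 1"
    by (simp add: mu)
  have "opens (graft (i - 1) (kids S) T) = i - 1 + opens S"
    using opens_graft[OF z(1) _ i, of "lab S"] z(2) by simp
  then show "num_open (mu i S T) = num_open S + i - 1"
    using z(1) kids_graft_ne[of "kids S"] assms(5) by (simp add: mu num_open_nontrivial)
qed

lemma beta01_nu:
  assumes "beta01_tree S" "num_open S = 1" "beta01_tree T" "T \<noteq> \<bullet>" "1 \<le> i" "i \<le> lab T"
  shows "beta01_tree (nu i S T)" "lab (nu i S T) = lab S + i - 1"
    "num_open (nu i S T) = num_open T + 1"
proof -
  have "S \<noteq> \<bullet>"
    using assms(2) by (auto simp: num_open_def)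
  note S = beta01_treeD[OF assms(1) this] and T = beta01_treeD[OF assms(3,4)]
  have nu: "nu i S T = plant (i - 1) (kids T) S"
    using assms(4) by (rule nu_eq_plant)
  have c: "i - 1 \<le> kid_sum (Node 0 (kids T))"
    using T(4) assms(6) by simp
  have valid: "\<forall>t\<in>set (kids T). valid_subtree t"
    using T(1) by (cases T) auto
  show "beta01_tree (nu i S T)"
    using valid_subtree_plant[OF T(3) valid c S(1)] excessive_plant[OF S(3)] S(2)
    by (simp add: nu beta01_tree_iff)
  show "lab (nu i S T) = lab S + i - 1"
    using assms(5) by (simp add: nu)
  have "opens (plant (i - 1) (kids T) S) = opens T + 1"
    using opens_plant[OF T(3) c S(1), of "lab T"] assms(2) S(3) by (simp add: num_open_nontrivial)
  then show "num_open (nu i S T) = num_open T + 1"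
    using T(3) kids_plant_ne by (simp add: nu num_open_nontrivial)
qed

lemma rho_eq: "Ts \<noteq> [] \<Longrightarrow> rho Ts = Node 1 (map (\<lambda>T. Node 0 (kids T)) Ts)"
  by (induction Ts rule: rho.induct) (auto simp: lam_def oplus_def)

lemma lab_rho [simp]: "Ts \<noteq> [] \<Longrightarrow> lab (rho Ts) = 1"
  by (simp add: rho_eq)

lemma beta01_rho:
  assumes "Ts \<noteq> []" "list_all beta01_tree Ts"
  shows "beta01_tree (rho Ts)"
proof -
  have "valid_subtree (Node 0 (kids T))" if "beta01_tree T" for T
    using that by (cases T) (auto simp: beta01_tree_iff)
  then show ?thesis
    using assms by (auto simp: rho_eq beta01_tree_def kid_sum_def list_all_iff o_def)
qed

text \<open>The last child has label 0 and so is moderate: if it is not a leaf, the root is open and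
  adds 1; otherwise only the leaf is open.\<close>

lemma num_open_rho:
  assumes "beta01_tree T"
  shows "num_open (rho (Ts @ [T])) = num_open T + 1"
proof (cases "T = \<bullet>")
  case False
  then have "kids T \<noteq> []"
    using assms beta01_treeD by blast
  then show ?thesis
    using opens_relabel[of 0 "kids T" "lab T"]
    by (simp add: rho_eq num_open_nontrivial) (simp add: num_open_def excessive_def)
qed (simp add: rho_eq num_open_def)

lemma sigma_snoc: "sigma (Us @ [U]) = mu 1 (rho (rev Us @ [\<bullet>])) U"
  by (simp add: sigma_def)

lemma beta01_bullet [simp]: "beta01_tree \<bullet>"
  by (simp add: beta01_tree_def)

lemma num_open_bullet [simp]: "num_open \<bullet> = 0"
  by (simp add: num_open_def)

lemma beta01_sigma:
  assumes "list_all beta01_tree Us" "beta01_tree U"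
  shows "beta01_tree (sigma (Us @ [U]))" "lab (sigma (Us @ [U])) = lab U + 1"
    "num_open (sigma (Us @ [U])) = 1"
proof -
  let ?S = "rho (rev Us @ [\<bullet>])"
  have S: "beta01_tree ?S" "lab ?S = 1" "num_open ?S = 1"
    using assms by (auto simp: beta01_rho num_open_rho)
  have "num_open U \<ge> 1" if "U \<noteq> \<bullet>"
    using that num_open_0[of U] by linarith
  then show "beta01_tree (sigma (Us @ [U]))" "lab (sigma (Us @ [U])) = lab U + 1"
    "num_open (sigma (Us @ [U])) = 1"
    using S beta01_mu[OF S(1,2) assms(2), of 1] unfolding sigma_snoc
    by (cases "U = \<bullet>"; simp)+
qed

lemma list_all2_rev_exhaust:
  assumes "list_all2 P xs ys" "xs \<noteq> []"
  obtains xs' x ys' y where "xs = xs' @ [x]" "ys = ys' @ [y]" "list_all2 P xs' ys'" "P x y"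
  using assms by (cases xs rule: rev_cases) (auto simp: list_all2_append1 list_all2_Cons1)

text \<open>The exchange of the two statistics makes \<open>nu\<close> legitimate in the rule
  \<open>mu\<close>: \<open>S'\<close> has one open node, and \<open>i \<le> lab T'\<close>.\<close>

lemma g_graph_beta01:
  "g_graph T U \<Longrightarrow> beta01_tree T \<and> beta01_tree U \<and> lab U = num_open T \<and> num_open U = lab T"
proof (induction rule: g_graph.induct)
  case (rho Ts Us)
  obtain Ts' T Us' U where *: "Ts = Ts' @ [T]" "Us = Us' @ [U]"
    "list_all2 (\<lambda>T U. g_graph T U \<and> beta01_tree T \<and> beta01_tree U \<and>
      lab U = num_open T \<and> num_open U = lab T) Ts' Us'"
    "g_graph T U \<and> beta01_tree T \<and> beta01_tree U \<and> lab U = num_open T \<and> num_open U = lab T"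
    by (rule list_all2_rev_exhaust[OF rho(3,1)])
  have "list_all beta01_tree Us'"
    using *(3) by (induction rule: list_all2_induct) auto
  then show ?case
    using * rho beta01_sigma[of Us' U] by (simp add: beta01_rho num_open_rho)
next
  case (mu S T i S' T')
  have "T' \<noteq> \<bullet>"
    using mu.IH mu.hyps num_open_0[of T] by auto
  then show ?case
    using mu beta01_mu[of S T i] beta01_nu[of S' T' i] by auto
qed simp

lemma g_graph_bullet_iff:
  "g_graph T U \<Longrightarrow> T = \<bullet> \<longleftrightarrow> U = \<bullet>"
  using g_graph_beta01[of T U] num_open_0[of T] num_open_0[of U] beta01_tree_lab_0 by metis

section \<open>The laws relating \<open>mu\<close> and \<open>nu\<close>\<close>

text \<open>Exchanging \<open>mu\<close> with \<open>nu\<close>, \<open>C\<close> with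
  \<open>S\<close> and \<open>j\<close> with \<open>i\<close> reverses the equation, so it serves
  for both arguments of \<open>g_graph\<close>.\<close>

lemma mu_nu_commute:
  assumes "beta01_tree S" "num_open S = 1" "beta01_tree C" "lab C = 1" "beta01_tree D" "D \<noteq> \<bullet>"
    and "1 \<le> i" "i \<le> lab D" "1 \<le> j" "j \<le> num_open D"
  shows "mu (j + 1) C (nu i S D) = nu (i + 1) S (mu j C D)"
proof -
  have "S \<noteq> \<bullet>"
    using assms(2) by auto
  note S = beta01_treeD[OF assms(1) this] and D = beta01_treeD[OF assms(5,6)]
  note nu = beta01_nu[OF assms(1,2,5,6,7,8)] and mu = beta01_mu[OF assms(3-6,9,10)]
  have ne: "nu i S D \<noteq> \<bullet>" "mu j C D \<noteq> \<bullet>"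
    using nu(3) mu(2) by auto
  have "mu (j + 1) C (nu i S D) = graft j (kids C) (plant (i - 1) (kids D) S)"
    using mu_eq_graft[OF ne(1), of "j + 1" C] nu(3) assms(10) nu_eq_plant[OF assms(6)] by simp
  also have "\<dots> = plant i (kids (graft (j - 1) (kids C) D)) S"
    using graft_plant[OF D(3) _ S(1), of "i - 1" "j - 1" "kids C"] D(4) S(3) assms
    by (simp add: num_open_nontrivial)
  also have "\<dots> = nu (i + 1) S (mu j C D)"
    using nu_eq_plant[OF ne(2)] mu_eq_graft[OF assms(6,9,10)] by simp
  finally show ?thesis .
qed

lemma nu_1_mu_1:
  assumes "beta01_tree A" "lab A = 1" "num_open A = 1"
    and "beta01_tree B" "B \<noteq> \<bullet>" "beta01_tree T" "T \<noteq> \<bullet>"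
  shows "nu 1 (mu 1 A B) T = mu 1 (nu 1 A T) B"
proof -
  have B: "1 \<le> num_open B"
    using assms(5) num_open_0[of B] by linarith
  show ?thesis
    using plant_0_graft_0[OF zero_labels(1)[OF assms(1,2)], of "kids T" B "lab A"] B assms(5,7)
    by (simp add: mu_eq_graft nu_eq_plant)
qed

lemma nu_1_rho: "T \<noteq> \<bullet> \<Longrightarrow> nu 1 (rho (Ts @ [\<bullet>])) T = rho (Ts @ [T])"
  by (simp add: nu_eq_plant rho_eq)

section \<open>Symmetry of the graph of \<open>g\<close>\<close>

lemma g_graph_bullet: "g_graph \<bullet> U \<longleftrightarrow> U = \<bullet>"
  using g_graph.bullet g_graph_bullet_iff by blast

lemma g_graph_rho_snoc:
  assumes "list_all2 g_graph Ts Us" "g_graph T U"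
  shows "g_graph (rho (Ts @ [T])) (sigma (Us @ [U]))"
proof -
  have "list_all beta01_tree Ts"
    using assms(1) by (induction rule: list_all2_induct) (auto dest: g_graph_beta01)
  then show ?thesis
    using assms g_graph_beta01 by (intro g_graph.rho) (auto simp: list_all2_appendI)
qed

lemma g_graph_nu_1:
  assumes "g_graph S S'" "num_open S = 1" "lab S = 1" "g_graph T T'" "T \<noteq> \<bullet>"
  shows "g_graph (nu 1 S T) (mu 1 S' T')"
  using assms(1)
proof cases
  case bullet
  then show ?thesis
    using assms(2) by simp
next
  case (rho Ts Us)
  then obtain Ts' R Us' V where *: "Ts = Ts' @ [R]" "Us = Us' @ [V]"
    "list_all2 g_graph Ts' Us'" "g_graph R V"
    using list_all2_rev_exhaust by metis
  \<comment> \<open>By \<open>num_open_rho\<close>, a single open node leaves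
    \<open>num_open R = 0\<close>.\<close>
  then have "R = \<bullet>"
    using assms(2) rho g_graph_beta01[OF *(4)] num_open_rho[of R Ts'] num_open_0[of R] by simp
  then have "V = \<bullet>"
    using *(4) g_graph_bullet by blast
  \<comment> \<open>Since \<open>V = \<bullet>\<close>, the tree \<open>S'\<close> is itself
    \<open>rho (rev Us' @ [\<bullet>])\<close>.\<close>
  have "mu 1 S' T' = sigma (Us' @ [T'])"
    by (simp add: rho * sigma_snoc \<open>V = \<bullet>\<close>)
  moreover have "nu 1 S T = rho (Ts' @ [T])"
    using nu_1_rho[OF assms(5)] by (simp add: rho * \<open>R = \<bullet>\<close>)
  ultimately show ?thesis
    using g_graph_rho_snoc[OF *(3) assms(4)] by simp
next
  case (mu C D j C' D')
  then show ?thesis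
    using beta01_mu(2)[of C D j] assms(3) beta01_tree_lab_0[of D] by simp
qed

lemma g_graph_nu:
  assumes "g_graph S S'" "num_open S = 1" "g_graph T T'" "T \<noteq> \<bullet>" "1 \<le> i" "i \<le> lab T"
  shows "g_graph (nu i S T) (mu i S' T')"
  using assms(5,3,4,6)
proof (induction i arbitrary: T T' rule: dec_induct)
  case base
  show ?case
  proof (cases "lab S = 1")
    case True
    then show ?thesis
      using g_graph_nu_1 assms(1,2) base by blast
  next
    case False
    from assms(1) show ?thesis
    proof cases
      case bullet
      then show ?thesis
        using assms(2) by simp
    next
      case (rho Ts Us)
      then show ?thesis
        using False by simp
    next
      case (mu A B j A' B')
      note A = g_graph_beta01[OF \<open>g_graph A A'\<close>] and B = g_graph_beta01[OF \<open>g_graph B B'\<close>]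
        and T = g_graph_beta01[OF \<open>g_graph T T'\<close>]
      have ne: "B' \<noteq> \<bullet>" "T' \<noteq> \<bullet>"
        using g_graph_bullet_iff \<open>g_graph B B'\<close> mu(6) base by blast+
      have "A \<noteq> \<bullet>"
        using mu by auto
      \<comment> \<open>Here \<open>num_open A + j - 1\<close> is 1, and both summands are at least
        1.\<close>
      then have "j = 1" "num_open A = 1"
        using beta01_mu(3)[of A B j] mu assms(2) num_open_0[of A] by auto
      have nuA: "g_graph (nu 1 A T) (mu 1 A' T')"
        using g_graph_nu_1 mu base \<open>num_open A = 1\<close> by blast
      have lab_nuA: "lab (nu 1 A T) = 1"
        using beta01_nu(2)[of A T 1] A T mu base \<open>num_open A = 1\<close> by simp
      \<comment> \<open>\<open>T\<close> is planted on \<open>A\<close>, which has root label 1,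
        before \<open>B\<close> comes back; \<open>nu_1_mu_1\<close> rewrites both
        arguments.\<close>
      have "g_graph (mu 1 (nu 1 A T) B) (nu 1 (mu 1 A' T') B')"
        using nuA lab_nuA g_graph_beta01[OF nuA] mu \<open>j = 1\<close> by (intro g_graph.mu) auto
      moreover have "mu 1 (nu 1 A T) B = nu 1 S T"
        using nu_1_mu_1[of A B T] A B T mu base \<open>num_open A = 1\<close> \<open>j = 1\<close> by simp
      moreover have "nu 1 (mu 1 A' T') B' = mu 1 S' T'"
        using nu_1_mu_1[of A' T' B'] A B T mu ne \<open>num_open A = 1\<close> \<open>j = 1\<close> by simp
      ultimately show ?thesis
        by simp
    qed
  qed
next
  case (step i)
  note S = g_graph_beta01[OF \<open>g_graph S S'\<close>]
  \<comment> \<open>The root label of \<open>T\<close> is at least 2, so only the rule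
    \<open>mu\<close> remains.\<close>
  from step.prems(1) show ?case
  proof cases
    case bullet
    then show ?thesis
      using step.prems by simp
  next
    case (rho Ts Us)
    then show ?thesis
      using step.prems step.hyps by simp
  next
    case (mu C D j C' D')
    note C = g_graph_beta01[OF \<open>g_graph C C'\<close>] and D = g_graph_beta01[OF \<open>g_graph D D'\<close>]
    have "D' \<noteq> \<bullet>"
      using g_graph_bullet_iff \<open>g_graph D D'\<close> mu by blast
    have i: "i \<le> lab D"
      using beta01_mu(2)[of C D j] mu step.prems by simp
    note nu = beta01_nu[of S D i] and IH = step.IH[OF \<open>g_graph D D'\<close> \<open>D \<noteq> \<bullet>\<close> i]
    \<comment> \<open>The index \<open>j + 1\<close> is legitimate because \<open>nu i S D\<close>
      has one open node more than \<open>D\<close>.\<close>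
    have "g_graph (mu (j + 1) C (nu i S D)) (nu (j + 1) C' (mu i S' D'))"
      using mu IH g_graph_beta01[OF IH] nu S assms(2) step.hyps i by (intro g_graph.mu) auto
    moreover have "mu (j + 1) C (nu i S D) = nu (Suc i) S T"
      using mu_nu_commute[of S C D i j] S C D mu assms(2) step.hyps i by simp
    moreover have "nu (j + 1) C' (mu i S' D') = mu (Suc i) S' T'"
      using mu_nu_commute[of C' S' D' j i] S C D mu assms(2) step.hyps i \<open>D' \<noteq> \<bullet>\<close> by simp
    ultimately show ?thesis
      by simp
  qed
qed

lemma g_graph_sym: "g_graph T U \<Longrightarrow> g_graph U T"
proof (induction rule: g_graph.induct)
  case (rho Ts Us)
  obtain Ts' T Us' U where *: "Ts = Ts' @ [T]" "Us = Us' @ [U]"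
    "list_all2 (\<lambda>T U. g_graph T U \<and> g_graph U T) Ts' Us'" "g_graph T U \<and> g_graph U T"
    by (rule list_all2_rev_exhaust[OF rho(3,1)])
  then have UT: "g_graph U T"
    by blast
  let ?S = "rho (rev Us' @ [\<bullet>])"
  have "list_all2 g_graph Us' Ts'"
    using *(3) by (induction rule: list_all2_induct) auto
  \<comment> \<open>This image equals \<open>rho (Ts' @ [\<bullet>])\<close>, the reversal being
    undone by \<open>sigma\<close>; planting \<open>T\<close> on it yields
    \<open>rho Ts\<close>.\<close>
  then have S: "g_graph ?S (sigma (rev Ts' @ [\<bullet>]))"
    by (intro g_graph_rho_snoc g_graph.bullet) simp
  show ?case
  proof (cases "U = \<bullet>")
    case True
    then have "T = \<bullet>"
      using UT g_graph_bullet by blast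
    then show ?thesis
      using S True by (simp add: * sigma_snoc)
  next
    case False
    then have T: "T \<noteq> \<bullet>"
      using UT g_graph_bullet_iff by blast
    have "1 \<le> num_open U"
      using False num_open_0[of U] by linarith
    then have "g_graph (mu 1 ?S U) (nu 1 (sigma (rev Ts' @ [\<bullet>])) T)"
      using S g_graph_beta01[OF S] g_graph_beta01[OF UT] UT False by (intro g_graph.mu) auto
    then show ?thesis
      using nu_1_rho[OF T, of Ts'] by (simp add: * sigma_snoc)
  qed
next
  case (mu S T i S' T')
  have "T' \<noteq> \<bullet>"
    using g_graph_bullet_iff mu by blast
  then show ?case
    using mu g_graph_beta01[of S S'] g_graph_beta01[of T T'] by (intro g_graph_nu) auto
qed (rule g_graph.bullet)

section \<open>Uniqueness of the decompositions\<close>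

text \<open>\<open>rho\<close> overwrites root labels by 0, but the children of a beta(0,1)-tree
  determine its root label.\<close>

lemma rho_inject:
  assumes "rho Ts = rho Us" "Ts \<noteq> []" "Us \<noteq> []" "list_all beta01_tree Ts" "list_all beta01_tree Us"
  shows "Ts = Us"
proof (rule map_inj_on)
  show "map (\<lambda>T. Node 0 (kids T)) Ts = map (\<lambda>T. Node 0 (kids T)) Us"
    using assms(1-3) by (simp add: rho_eq)
  show "inj_on (\<lambda>T. Node 0 (kids T)) (set Ts \<union> set Us)"
  proof (rule inj_onI)
    fix T U
    assume "T \<in> set Ts \<union> set Us" "U \<in> set Ts \<union> set Us" and "Node 0 (kids T) = Node 0 (kids U)"
    then have "beta01_tree T" "beta01_tree U" and kids: "kids T = kids U"
      using assms(4,5) by (auto simp: list_all_iff)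
    then have "lab T = lab U"
      by (auto simp: beta01_tree_def kid_sum_def)
    then show "T = U"
      using kids by (simp add: tree.expand)
  qed
qed

lemma mu_inject:
  assumes "mu i S T = mu j U V"
    and "beta01_tree S" "lab S = 1" "beta01_tree T" "T \<noteq> \<bullet>" "1 \<le> i" "i \<le> num_open T"
    and "beta01_tree U" "lab U = 1" "beta01_tree V" "V \<noteq> \<bullet>" "1 \<le> j" "j \<le> num_open V"
  shows "i = j \<and> S = U \<and> T = V"
proof -
  have "graft (i - 1) (kids S) T = graft (j - 1) (kids U) V"
    using assms mu_eq_graft by metis
  then have "i - 1 = j - 1 \<and> kids S = kids U \<and> T = V"
    using zero_labels[OF assms(2,3)] zero_labels[OF assms(8,9)] assms
    by (intro graft_inject) (auto simp: num_open_def)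
  then show ?thesis
    using assms by (auto intro: tree.expand)
qed

text \<open>A root label of 0, 1 or more tells which rule applies; injectivity of \<open>rho\<close>
  and \<open>mu\<close> does the rest.\<close>

lemma g_graph_unique: "g_graph T U \<Longrightarrow> g_graph T V \<Longrightarrow> U = V"
proof (induction arbitrary: V rule: g_graph.induct)
  case bullet
  then show ?case
    by (simp add: g_graph_bullet)
next
  case IH: (rho Ts Us)
  from IH.prems show ?case
  proof cases
    case bullet
    then show ?thesis
      using IH(1) lab_rho[of Ts] by simp
  next
    case (rho Ts' Vs)
    then have "list_all2 g_graph Ts Vs"
      using rho_inject[of Ts Ts'] IH(1,2) by simp
    then have "Us = Vs"
      using IH(3) by (auto simp: list_all2_conv_all_nth intro: nth_equalityI)
    then show ?thesis
      using rho by simp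
  next
    case (mu C D j C' D')
    then show ?thesis
      using beta01_mu(2)[of C D j] lab_rho[of Ts] beta01_tree_lab_0[of D] IH(1) by simp
  qed
next
  case IH: (mu S T i S' T')
  from IH.prems show ?case
  proof cases
    case bullet
    then show ?thesis
      using beta01_mu(2)[of S T i] IH.hyps by simp
  next
    case (rho Ts Us)
    then show ?thesis
      using beta01_mu(2)[of S T i] IH.hyps lab_rho[of Ts] beta01_tree_lab_0[of T] by simp
  next
    case (mu C D j C' D')
    then show ?thesis
      using mu_inject[of i S T j C D] IH by blast
  qed
qed

section \<open>Existence of the decompositions and totality\<close>

lemma rho_cases:
  assumes "beta01_tree T" "lab T = 1"
  obtains Ts where "T = rho Ts" "Ts \<noteq> []" "list_all beta01_tree Ts" "\<forall>T'\<in>set Ts. size T' < size T"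
proof -
  note z = zero_labels[OF assms]
  \<comment> \<open>\<open>f\<close> restores the root label that \<open>rho\<close> replaced by
    0.\<close>
  define f where "f k = Node (if is_leaf k then 0 else kid_sum k + 1) (kids k)" for k
  have "\<forall>k\<in>set (kids T). Node 0 (kids (f k)) = k"
    using z(2) by (metis f_def tree.exhaust_sel tree.sel(2))
  then have "rho (map f (kids T)) = T"
    using z(1) assms(2) by (simp add: rho_eq tree.expand map_idI)
  moreover have "beta01_tree (f k)" if "k \<in> set (kids T)" for k
  proof -
    have "valid_subtree k"
      using z(2) that by blast
    then show ?thesis
      by (cases k) (auto simp: f_def beta01_tree_def kid_sum_def split: if_splits)
  qed
  moreover have "size (f k) < size T" if "k \<in> set (kids T)" for k
  proof -
    have "size (f k) = size k"
      by (cases k) (simp add: f_def)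
    also have "\<dots> < size T"
      using that by (cases T) (auto dest: size_list_estimation' simp: less_Suc_eq_le)
    finally show ?thesis .
  qed
  ultimately show thesis
    using that[of "map f (kids T)"] z(1) by (simp add: list_all_iff)
qed

lemma mu_cases:
  assumes "beta01_tree T" "lab T > 1"
  obtains i S U where "T = mu i S U" "beta01_tree S" "lab S = 1" "beta01_tree U" "U \<noteq> \<bullet>"
    "1 \<le> i" "i \<le> num_open U" "size S < size T" "size U < size T"
proof -
  have T: "valid_subtree T" "excessive T"
    using beta01_treeD[OF assms(1)] assms(2) by (metis not_less_zero tree.sel(1))+
  obtain i ss t where t: "T = graft i ss t" "i < opens t" "valid_subtree t"
    "ss \<noteq> []" "\<forall>s\<in>set ss. lab s = 0 \<and> valid_subtree s"
    using graft_cases[OF T(1)] assms(2) by (metis gr_zeroI not_less_zero)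
  \<comment> \<open>Root label above 1 keeps \<open>t\<close> from being \<bullet>, as
    \<open>graft\<close> adds only 1.\<close>
  have "lab t > 0"
    using assms(2) t(1) by simp
  then have "kids t \<noteq> []"
    using t(3) by (cases t) auto
  then have "beta01_tree t"
    using T(2) t excessive_graft[of ss i t] by (simp add: beta01_tree_iff)
  \<comment> \<open>The trees in \<open>ss\<close> have label 0, so their common root takes label
    1.\<close>
  moreover have "beta01_tree (Node 1 ss)"
    using t(4,5) by (auto simp: beta01_tree_def kid_sum_def)
  moreover have "mu (i + 1) (Node 1 ss) t = T"
    using t(1,2) \<open>kids t \<noteq> []\<close> by (subst mu_eq_graft) (auto simp: num_open_nontrivial)
  moreover have "size (Node 1 ss) < size T" "size t < size T"
  proof -
    have "size t > 1"
      using \<open>kids t \<noteq> []\<close> by (cases t; cases "kids t") auto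
    moreover have "size_list size ss > 0"
      using t(4) by (cases ss) auto
    ultimately show "size (Node 1 ss) < size T" "size t < size T"
      using size_graft[OF t(2), of ss] t(1) by simp_all
  qed
  moreover have "t \<noteq> \<bullet>"
    using \<open>kids t \<noteq> []\<close> by auto
  ultimately show thesis
    using that[of "i + 1" "Node 1 ss" t] t(2) \<open>kids t \<noteq> []\<close> by (auto simp: num_open_nontrivial)
qed

lemma g_graph_total: "beta01_tree T \<Longrightarrow> \<exists>U. g_graph T U"
proof (induction "size T" arbitrary: T rule: less_induct)
  case less
  consider "lab T = 0" | "lab T = 1" | "lab T > 1"
    by linarith
  then show ?case
  proof cases
    case 1
    then show ?thesis
      using less.prems beta01_tree_lab_0 g_graph.bullet by blast
  next
    case 2
    then obtain Ts where Ts: "T = rho Ts" "Ts \<noteq> []" "list_all beta01_tree Ts"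
      "\<forall>T'\<in>set Ts. size T' < size T"
      using rho_cases less.prems by blast
    then have "\<forall>T'\<in>set Ts. \<exists>U. g_graph T' U"
      using less.hyps by (auto simp: list_all_iff)
    then obtain f where "\<forall>T'\<in>set Ts. g_graph T' (f T')"
      by metis
    then have "list_all2 g_graph Ts (map f Ts)"
      by (simp add: list_all2_conv_all_nth)
    then show ?thesis
      using Ts g_graph.rho by blast
  next
    case 3
    then show ?thesis
      using mu_cases[OF less.prems 3] less.hyps g_graph.mu by metis
  qed
qed

theorem theorem10:
  fixes T :: tree
  assumes "beta01_tree T"
  shows "beta01_tree (g T) \<and> g (g T) = T"
proof -
  have g: "g A = B" if "g_graph A B" for A B
    using that g_graph_unique unfolding g_def by blast
  obtain U where "g_graph T U"
    using g_graph_total[OF assms] by blast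
  then show ?thesis
    using g g_graph_sym g_graph_beta01 by metis
qed

end
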